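(* Let $n \ge 0$, and let $b_1,\dots,b_{n-1}$ and $d_1,\dots,d_n$ be elements of a commutative ring. Let $M_{b_1 \dots b_{n-1}}^{d_1 \dots d_n}$ be the $n\times n$ matrix with entries \[ M_{ij} = \begin{cases} b_i & \text{if } i<j,\\ b_j & \text{if } j<i,\\ d_i & \text{if } i=j. \end{cases} \] For $0 \le k \le n$, let $D_k = \det\left(M_{b_1 \dots b_{k-1}}^{d_1 \dots d_k}\right)$ (the $k\times k$ weighted threshold graph matrix built from $b_1,\dots,b_{k-1}$ and $d_1,\dots,d_k$), where the determinant of the $0\times 0$ matrix is defined to be $1$. Then \[ D_k = \begin{cases} 1 & \text{if } k=0,\\ d_1 & \text{if } k=1,\\ (d_k + d_{k-1} - 2b_{k-1})\, D_{k-1} - (b_{k-1}-d_{k-1})^2\, D_{k-2} & \text{if } k\ge 2. \end{cases} \]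
   Context: The matrix $M_{b_1 \dots b_{n-1}}^{d_1 \dots d_n}$ is called a weighted threshold graph matrix. *)

theory Defs
  imports "Jordan_Normal_Form.Determinant"
begin

text \<open>
  The weights are sequences indexed from 1: \<open>b 1, ..., b (n - 1)\<close> and \<open>d 1, ..., d n\<close>; no other
  values of \<open>b\<close> and \<open>d\<close> occur in the matrix. Library matrices are indexed from 0, so the
  entry at position \<open>(i, j)\<close> is the entry in row \<open>i + 1\<close> and column \<open>j + 1\<close> in 1-based numbering.
\<close>

definition weighted_threshold_graph_matrix ::
    "nat \<Rightarrow> (nat \<Rightarrow> 'a) \<Rightarrow> (nat \<Rightarrow> 'a) \<Rightarrow> 'a mat" where
  "weighted_threshold_graph_matrix n b d =
     mat n n (\<lambda>(i, j). if i < j then b (i + 1) else if j < i then b (j + 1) else d (i + 1))"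

definition wtg_det :: "(nat \<Rightarrow> 'a :: comm_ring_1) \<Rightarrow> (nat \<Rightarrow> 'a) \<Rightarrow> nat \<Rightarrow> 'a" where
  "wtg_det b d k = det (weighted_threshold_graph_matrix k b d)"

end

theory Submission imports Defs begin

text \<open>
  The last two rows of the matrix agree except in the last two columns, and likewise for the
  columns. Subtracting the penultimate row and then the penultimate column from the last ones
  therefore clears the border up to its last two entries, and expanding along the border leaves
  only \<open>D (k - 1)\<close> and \<open>D (k - 2)\<close>.
\<close>

text \<open>Expanding along the last row leaves two terms; the one from column \<open>m\<close> has
  sign (-1)^(2m+1), hence the minus. Its minor is expanded once more, along its last column.\<close>

lemma det_almost_zero_border:
  fixes A :: "'a :: comm_ring_1 mat"
  assumes A: "A \<in> carrier_mat (Suc (Suc m)) (Suc (Suc m))"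
    and row: "\<And>j. j < m \<Longrightarrow> A $$ (Suc m, j) = 0"
    and col: "\<And>i. i < m \<Longrightarrow> A $$ (i, Suc m) = 0"
  shows "det A = A $$ (Suc m, Suc m) * det (mat (Suc m) (Suc m) (\<lambda>ij. A $$ ij))
    - A $$ (Suc m, m) * A $$ (m, Suc m) * det (mat m m (\<lambda>ij. A $$ ij))"
proof -
  let ?B = "mat_delete A (Suc m) m"
  have B: "?B \<in> carrier_mat (Suc m) (Suc m)"
    using A by (auto simp: mat_delete_def)
  have minor: "mat_delete A (Suc m) (Suc m) = mat (Suc m) (Suc m) (\<lambda>ij. A $$ ij)"
    using A by (auto simp: mat_delete_def)
  have minor2: "mat_delete ?B m m = mat m m (\<lambda>ij. A $$ ij)"
    using A by (auto simp: mat_delete_def)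
  \<comment> \<open>Deleting column \<open>m\<close> shifts the last column of \<open>A\<close> into
    position \<open>m\<close>, and \<open>col\<close> leaves it only the entry from row
    \<open>m\<close>.\<close>
  have B_col: "?B $$ (i, m) = (if i = m then A $$ (m, Suc m) else 0)" if "i < Suc m" for i
    using that A col by (auto simp: mat_delete_def)
  have det_B: "det ?B = A $$ (m, Suc m) * det (mat m m (\<lambda>ij. A $$ ij))"
    by (subst laplace_expansion_column[OF B, of m]) (simp_all add: B_col cofactor_def minor2)
  show ?thesis
    by (subst laplace_expansion_row[OF A, of "Suc m"])
      (simp_all add: row cofactor_def minor det_B)
qed

lemma wtg_det_rec:
  fixes b d :: "nat \<Rightarrow> 'a :: comm_ring_1"
  shows "wtg_det b d (Suc (Suc m)) =
    (d (m + 2) + d (m + 1) - 2 * b (m + 1)) * wtg_det b d (Suc m)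
      - (b (m + 1) - d (m + 1))\<^sup>2 * wtg_det b d m"
proof -
  let ?n = "Suc (Suc m)"
  let ?M = "weighted_threshold_graph_matrix ?n b d"
  let ?L = "addrow (- 1) (Suc m) m ?M"
  define N where "N = addcol (- 1) (Suc m) m ?L"
  have M: "?M \<in> carrier_mat ?n ?n"
    by (simp add: weighted_threshold_graph_matrix_def)
  then have L: "?L \<in> carrier_mat ?n ?n"
    by simp
  then have N: "N \<in> carrier_mat ?n ?n"
    unfolding N_def carrier_mat_def by simp
  have "det N = det ?L"
    unfolding N_def by (rule det_addcol[OF _ _ L]) simp_all
  also have "\<dots> = det ?M"
    by (rule det_addrow[OF _ _ M]) simp_all
  finally have det_N: "det N = det ?M" .
  \<comment> \<open>Both operations change only the last row and column, so the smaller leading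
    blocks are those of the original matrix.\<close>
  have minors:
    "mat (Suc m) (Suc m) (\<lambda>ij. N $$ ij) = weighted_threshold_graph_matrix (Suc m) b d"
    "mat m m (\<lambda>ij. N $$ ij) = weighted_threshold_graph_matrix m b d"
    by (rule eq_matI; simp add: N_def weighted_threshold_graph_matrix_def)+
  \<comment> \<open>The row operation turns the corner into \<open>d (m + 2) - b (m + 1)\<close>;
    the column operation then subtracts \<open>b (m + 1) - d (m + 1)\<close>.\<close>
  have corner:
    "N $$ (Suc m, Suc m) = d (m + 2) + d (m + 1) - 2 * b (m + 1)"
    "N $$ (Suc m, m) = b (m + 1) - d (m + 1)"
    "N $$ (m, Suc m) = b (m + 1) - d (m + 1)"
    by (simp_all add: N_def weighted_threshold_graph_matrix_def)
  \<comment> \<open>For \<open>j < m\<close> both entries subtracted from each other equal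
    \<open>b (j + 1)\<close>, the weight of the smaller index.\<close>
  have border: "N $$ (Suc m, j) = 0" "N $$ (j, Suc m) = 0" if "j < m" for j
    using that by (simp_all add: N_def weighted_threshold_graph_matrix_def)
  show ?thesis
    using det_almost_zero_border[OF N border]
    unfolding wtg_det_def det_N minors corner power2_eq_square .
qed

theorem theorem1:
  fixes b d :: "nat \<Rightarrow> 'a :: comm_ring_1" and n k :: nat
  assumes "k \<le> n"
  shows "wtg_det b d k =
    (if k = 0 then 1
     else if k = 1 then d 1
     else (d k + d (k - 1) - 2 * b (k - 1)) * wtg_det b d (k - 1)
            - (b (k - 1) - d (k - 1))\<^sup>2 * wtg_det b d (k - 2))"
proof -
  \<comment> \<open>Writing \<open>k\<close> as \<open>Suc (Suc m)\<close> makes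
    \<open>k - 1\<close> and \<open>k - 2\<close> free of truncation.\<close>
  consider "k = 0" | "k = 1" | m where "k = Suc (Suc m)"
    by (metis One_nat_def not0_implies_Suc)
  then show ?thesis
  proof cases
    case 1
    then show ?thesis
      by (simp add: wtg_det_def weighted_threshold_graph_matrix_def)
  next
    case 2
    then show ?thesis
      by (simp add: wtg_det_def weighted_threshold_graph_matrix_def det_single)
  next
    case 3
    then show ?thesis
      using wtg_det_rec[of b d m] by simp
  qed
qed

end
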